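(* Let $R$ be a finite commutative ring with unity and let $\Gamma'(R)$ be the unity product graph associated with $R$. Then $\Gamma'(R)$ is not Hamiltonian.
   Context: For a ring $R$ with unity $e$, let $U(R)$ denote the set of units of $R$. The unity product graph $\Gamma'(R)$ is the simple graph with vertex set $U(R)$ in which two distinct vertices $r_i,r_j$ are adjacent if and only if $r_i\cdot r_j=e$. A graph is Hamiltonian if it contains a Hamiltonian cycle, i.e. a cycle (of length at least $3$) that contains every vertex of the graph; in particular a graph with no cycle, including the one-vertex graph, is not Hamiltonian. *)

theory Defs
  imports "HOL-Algebra.Ring" "Graph_Theory.Pair_Digraph"
begin

text \<open>
  Simple graphs are represented, as in \<^locale>\<open>pair_graph\<close>, by irreflexive symmetric arc
  relations: an undirected edge is a pair of opposite arcs.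
\<close>

definition unity_product_graph :: "('a, 'm) ring_scheme \<Rightarrow> 'a pair_pre_digraph" where
  "unity_product_graph R =
    \<lparr> pverts = Units R,
      parcs = {(r, s). r \<in> Units R \<and> s \<in> Units R \<and> r \<noteq> s \<and> r \<otimes>\<^bsub>R\<^esub> s = \<one>\<^bsub>R\<^esub>} \<rparr>"

lemma pair_graph_unity_product_graph:
  assumes "ring R" and "finite (carrier R)"
  shows "pair_graph (unity_product_graph R)"
proof -
  interpret ring R by fact
  have fin: "finite (Units R)"
    using assms(2) by (rule finite_subset[rotated]) auto
  have "finite (parcs (unity_product_graph R))"
    by (rule finite_subset[of _ "Units R \<times> Units R"]) (auto simp: unity_product_graph_def fin)
  moreover have "s \<otimes>\<^bsub>R\<^esub> r = \<one>\<^bsub>R\<^esub>"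
    if "r \<in> Units R" "s \<in> Units R" "r \<otimes>\<^bsub>R\<^esub> s = \<one>\<^bsub>R\<^esub>" for r s
    using that by (metis Units_closed Units_inv_closed Units_r_inv inv_unique Units_l_inv)
  ultimately show ?thesis
    by unfold_locales
      (auto simp: unity_product_graph_def fin symmetric_def arcs_ends_conv with_proj_def
        intro!: symI)
qed

text \<open>
  The library notion \<^const>\<open>pre_digraph.cycle\<close> is the one for digraphs and counts the closed walk
  a, b, a along an edge and its reverse as a cycle.  The length bound excludes it; for length at
  least three, the cycles of a symmetric digraph without parallel arcs are exactly the (rooted
  and oriented) cycles of the undirected graph.
\<close>

definition hamiltonian_cycle :: "'a pair_pre_digraph \<Rightarrow> ('a \<times> 'a) awalk \<Rightarrow> bool" where
  "hamiltonian_cycle G p \<longleftrightarrow>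
    pre_digraph.cycle (with_proj G) p \<and> 3 \<le> length p \<and> pverts G \<subseteq> fst ` set p"

definition hamiltonian :: "'a pair_pre_digraph \<Rightarrow> bool" where
  "hamiltonian G \<longleftrightarrow> (\<exists>p. hamiltonian_cycle G p)"

end

theory Submission
  imports Defs
begin

text \<open>
  An inverse is unique, so every vertex of the unity product graph has at most one neighbour:
  the graph is a matching together with isolated vertices.  A cycle of length at least three
  would give each of its vertices two different neighbours.  Hence the graph has no
  such cycle at all, spanning or not.
\<close>

text \<open>
  Distinctness of the vertices of a cycle forbids turning back along an edge, unless the
  turn already closes the cycle, as in the closed walk \<open>a, b, a\<close> of length two.
\<close>

lemma long_cycle_two_step:
  assumes "pre_digraph.cycle (with_proj G) p" and "3 \<le> length p"
  obtains a b c where "(a, b) \<in> parcs G" "(b, c) \<in> parcs G" "a \<noteq> c"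
proof -
  obtain e1 e2 e3 es where p: "p = e1 # e2 # e3 # es"
    using assms(2) by (auto simp: numeral_3_eq_3 Suc_le_length_iff)
  obtain u where walk: "pre_digraph.awalk (with_proj G) u p u"
    and distinct: "distinct (tl (pre_digraph.awalk_verts (with_proj G) u p))"
    using assms(1) unfolding pre_digraph.cycle_def by blast
  have cas: "pre_digraph.cas (with_proj G) u p u" and arcs: "set p \<subseteq> parcs G"
    using walk by (auto simp: pre_digraph.awalk_def)
  \<comment> \<open>The walk returns to \<open>u\<close> only at its last vertex, which lies beyond the second arc
    because a third one follows.\<close>
  have "u \<in> set (pre_digraph.awalk_verts (with_proj G) (snd e3) es)"
    using cas unfolding p
    by (induction es arbitrary: e3)
       (auto simp: pre_digraph.cas.simps pre_digraph.awalk_verts.simps)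
  moreover have "snd e2 \<notin> set (pre_digraph.awalk_verts (with_proj G) (snd e3) es)"
    using cas distinct unfolding p
    by (cases es) (auto simp: pre_digraph.cas.simps pre_digraph.awalk_verts.simps)
  ultimately have "u \<noteq> snd e2" by blast
  moreover have "e1 = (u, snd e1)" "e2 = (snd e1, snd e2)"
    using cas by (auto simp: p pre_digraph.cas.simps prod_eq_iff)
  ultimately show thesis
    using arcs that[of u "snd e1" "snd e2"] by (auto simp: p)
qed

lemma (in ring) unity_product_graph_neighbour_unique:
  assumes "(a, b) \<in> parcs (unity_product_graph R)" and "(b, c) \<in> parcs (unity_product_graph R)"
  shows "a = c"
  using assms inv_unique[of a b c] by (auto simp: unity_product_graph_def Units_closed)

theorem theorem6p3:
  fixes R :: "('a, 'm) ring_scheme"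
  assumes "cring R" and "finite (carrier R)"
  shows "\<not> hamiltonian (unity_product_graph R)"
proof
  assume "hamiltonian (unity_product_graph R)"
  then obtain a b c where "(a, b) \<in> parcs (unity_product_graph R)"
    "(b, c) \<in> parcs (unity_product_graph R)" "a \<noteq> c"
    unfolding hamiltonian_def hamiltonian_cycle_def by (blast elim: long_cycle_two_step)
  with ring.unity_product_graph_neighbour_unique[OF cring.axioms(1)[OF \<open>cring R\<close>]] show False
    by blast
qed

end
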